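(* Let $n\ge4$ be even, let $F$ be an algebraically closed field of characteristic $0$, and let $L$ be an $(n+1)$-dimensional $n$-Lie algebra over $F$ with basis $e_1,\dots,e_{n+1}$ given by one of the following four cases (brackets of basis elements not determined by the listed ones and the alternating property are zero; $L^1$ denotes the derived algebra): (0) $L^1=\{0\}$: $L$ is the Abelian $n$-Lie algebra. (1)(a) $L^1=Fe_1$, where $[e_2,\dots,e_{n+1}]=e_1$. (2)(a) $L^1=Fe_1\oplus Fe_2$, where $[e_2,\dots,e_{n+1}]=e_1$ and $[e_1,e_3,\dots,e_{n+1}]=e_2$. ($r$) $L^1=Fe_1\oplus\cdots\oplus Fe_r$ ($3\le r\le n$), where $[e_1,\dots,\widehat{e}_i,\dots,e_{n+1}]=e_i$ for $1\le i\le r$. Then, in each case, the generators $\{G_1,\dots,G_{n+1}\}$ defined in the context form a Gröbner basis (with respect to the degree-lexicographical order) of the ideal $I=\langle G_1,\dots,G_{n+1}\rangle\subseteq F\langle X\rangle$, $X=\{x_1,\dots,x_{n+1}\}$.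
   Context: An $n$-Lie algebra is a vector space over a field of characteristic $\neq2$ with a multilinear alternating operation $[z_1,\dots,z_n]$ (permuting arguments by $\sigma$ multiplies by the sign $\epsilon(\sigma)$) satisfying $[[z_1,\dots,z_n],w_2,\dots,w_n]=\sum_{i=1}^n[z_1,\dots,[z_i,w_2,\dots,w_n],\dots,z_n]$. $L^1$ is the span of all brackets. A hat means the entry is omitted. $F\langle X\rangle$ is the free unital associative algebra, with basis the words $X^*$. Let $\phi\colon L\to F\langle X\rangle$ be linear with $\phi(e_i)=x_i$, let $y_i=\phi([e_1,\dots,\widehat{e}_i,\dots,e_{n+1}])$, let $\mathrm{alt}(z_1,\dots,z_n)=\sum_{\sigma\in S_n}\epsilon(\sigma)z_{\sigma(1)}\cdots z_{\sigma(n)}$, and $$G_i=(-1)^{\lfloor n/2\rfloor}\big(\mathrm{alt}(x_1,\dots,\widehat{x}_i,\dots,x_{n+1})-y_i\big)\quad(1\le i\le n+1).$$ Degree-lexicographical order on words: $u<v$ iff $\deg u<\deg v$, or $\deg u=\deg v$ and at the first position where they differ $u$ has $x_i$ and $v$ has $x_j$ with $i<j$. $\mathrm{LM}(f)$ is the largest word occurring with nonzero coefficient in $f\ne0$. A word $u$ is a factor of $v$ if $v=w_1uw_2$ for some words $w_1,w_2$. A subset $G$ of a two-sided ideal $I$ is a Gröbner basis of $I$ if for every nonzero $f\in I$ there is $g\in G$ such that $\mathrm{LM}(g)$ is a factor of $\mathrm{LM}(f)$. *)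

theory Defs
  imports
    "HOL-Library.Poly_Mapping"
    "HOL-Library.Sublist"
    "HOL-Combinatorics.Permutations"
    "HOL-Computational_Algebra.Polynomial"
    "HOL-Algebra.Ideal"
begin

section \<open>\<open>n\<close>-Lie algebras\<close>

text \<open>
  The bracket takes the list of its arguments; only its values on lists of length \<open>n\<close> matter.
  The vector space is the whole type \<open>'l\<close>.
\<close>

locale n_Lie_algebra = vector_space scale
  for scale :: "'f::field \<Rightarrow> 'l::ab_group_add \<Rightarrow> 'l" +
  fixes n :: nat and br :: "'l list \<Rightarrow> 'l"
  assumes char_neq_2: "(2::'f) \<noteq> 0"
    and multilinear:
      "length zs = n \<Longrightarrow> i < n \<Longrightarrow> Vector_Spaces.linear scale scale (\<lambda>z. br (zs[i := z]))"
    and alternating: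
      "length zs = n \<Longrightarrow> \<sigma> permutes {..<n} \<Longrightarrow>
        br (permute_list \<sigma> zs) = scale (of_int (sign \<sigma>)) (br zs)"
    and derivation:
      "length zs = n \<Longrightarrow> length ws = n - 1 \<Longrightarrow>
        br (br zs # ws) = (\<Sum>i<n. br (zs[i := br (zs ! i # ws)]))"

text \<open>The indices \<open>1, \<dots>, n + 1\<close> in increasing order, with \<open>i\<close> omitted.\<close>

definition omit :: "nat \<Rightarrow> nat \<Rightarrow> nat list" where
  "omit n i = filter (\<lambda>j. j \<noteq> i) [1..<n + 2]"

context n_Lie_algebra
begin

definition derived_algebra :: "'l set" where
  "derived_algebra = span {br zs | zs. length zs = n}"

definition is_basis :: "(nat \<Rightarrow> 'l) \<Rightarrow> bool" where
  "is_basis e \<longleftrightarrow>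
    inj_on e {1..n + 1} \<and> independent (e ` {1..n + 1}) \<and> span (e ` {1..n + 1}) = UNIV"

text \<open>
  If \<open>br (map e (omit n i))\<close> is listed exactly for \<open>i \<in> S\<close>, the alternating property
  determines the brackets of rearrangements of these index lists; all others vanish.
\<close>

definition unlisted_brackets_zero :: "(nat \<Rightarrow> 'l) \<Rightarrow> nat set \<Rightarrow> bool" where
  "unlisted_brackets_zero e S \<longleftrightarrow>
    (\<forall>ks. length ks = n \<and> set ks \<subseteq> {1..n + 1} \<and> (\<forall>i\<in>S. mset ks \<noteq> mset (omit n i)) \<longrightarrow>
      br (map e ks) = 0)"

definition case_0 :: bool where
  "case_0 \<longleftrightarrow> derived_algebra = {0}"

definition case_1a :: "(nat \<Rightarrow> 'l) \<Rightarrow> bool" where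
  "case_1a e \<longleftrightarrow>
    derived_algebra = span {e 1} \<and>
    br (map e [2..<n + 2]) = e 1 \<and>
    unlisted_brackets_zero e {1}"

definition case_2a :: "(nat \<Rightarrow> 'l) \<Rightarrow> bool" where
  "case_2a e \<longleftrightarrow>
    derived_algebra = span {e 1, e 2} \<and>
    br (map e [2..<n + 2]) = e 1 \<and>
    br (e 1 # map e [3..<n + 2]) = e 2 \<and>
    unlisted_brackets_zero e {1, 2}"

definition case_r :: "(nat \<Rightarrow> 'l) \<Rightarrow> nat \<Rightarrow> bool" where
  "case_r e r \<longleftrightarrow>
    derived_algebra = span (e ` {1..r}) \<and>
    (\<forall>i\<in>{1..r}. br (map e (omit n i)) = e i) \<and>
    unlisted_brackets_zero e {1..r}"

end


section \<open>Free associative algebras\<close>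

text \<open>
  Words form a monoid under concatenation, written additively because the convolution product of
  \<^type>\<open>poly_mapping\<close> is. Hence \<open>'x list \<Rightarrow>\<^sub>0 'f\<close> is the free unital
  associative algebra on all of \<open>'x\<close>. (This instance is incompatible with the one in
  \<open>HOL-Library.ListVector\<close>.)
\<close>

instantiation list :: (type) monoid_add
begin
definition zero_list :: "'a list" where "zero_list = []"
definition plus_list :: "'a list \<Rightarrow> 'a list \<Rightarrow> 'a list" where "plus_list u v = u @ v"
instance by standard (simp_all add: zero_list_def plus_list_def)
end

definition fa_scale :: "'f::ring_1 \<Rightarrow> ('x list \<Rightarrow>\<^sub>0 'f) \<Rightarrow> ('x list \<Rightarrow>\<^sub>0 'f)" where
  "fa_scale c f = Poly_Mapping.map ((*) c) f"

definition fa_var :: "'x \<Rightarrow> ('x list \<Rightarrow>\<^sub>0 'f::ring_1)" where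
  "fa_var x = Poly_Mapping.single [x] 1"

text \<open>\<open>F\<langle>X\<rangle>\<close> for a subset \<open>X\<close> of the type of letters.\<close>

definition free_algebra :: "'x set \<Rightarrow> ('x list \<Rightarrow>\<^sub>0 'f::ring_1) ring" where
  "free_algebra X =
    \<lparr>carrier = {f. \<forall>w\<in>Poly_Mapping.keys f. set w \<subseteq> X},
     monoid.mult = (*), one = 1, zero = 0, add = (+)\<rparr>"

lemma lookup_fa_scale [simp]: "Poly_Mapping.lookup (fa_scale c f) w = c * Poly_Mapping.lookup f w"
  by (simp add: fa_scale_def Poly_Mapping.map.rep_eq when_def)

lemma vector_space_fa_scale: "vector_space (fa_scale :: 'f::field \<Rightarrow> ('x list \<Rightarrow>\<^sub>0 'f) \<Rightarrow> _)"
  by standard (auto intro!: poly_mapping_eqI simp: lookup_add algebra_simps)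

lemma ring_free_algebra: "Ring.ring (free_algebra X :: ('x list \<Rightarrow>\<^sub>0 'f::ring_1) ring)"
proof -
  let ?R = "free_algebra X :: ('x list \<Rightarrow>\<^sub>0 'f) ring"
  have add: "f + g \<in> carrier ?R" if "f \<in> carrier ?R" "g \<in> carrier ?R" for f g
    using that Poly_Mapping.keys_add[of f g] by (fastforce simp: free_algebra_def)
  have mult: "f * g \<in> carrier ?R" if "f \<in> carrier ?R" "g \<in> carrier ?R" for f g
    using that Poly_Mapping.keys_mult[of f g] by (fastforce simp: free_algebra_def plus_list_def)
  have zero: "0 \<in> carrier ?R" by (simp add: free_algebra_def)
  have one: "1 \<in> carrier ?R"
    using Poly_Mapping.single_one[symmetric, where 'a = "'x list" and 'b = 'f]
    by (simp add: free_algebra_def zero_list_def)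
  have uminus: "- f \<in> carrier ?R" if "f \<in> carrier ?R" for f
    using that by (auto simp: free_algebra_def in_keys_iff)
  have ops: "f \<oplus>\<^bsub>?R\<^esub> g = f + g" "f \<otimes>\<^bsub>?R\<^esub> g = f * g" "\<zero>\<^bsub>?R\<^esub> = 0" "\<one>\<^bsub>?R\<^esub> = 1" for f g
    by (simp_all add: free_algebra_def)
  show ?thesis
  proof (rule ringI)
    show "abelian_group ?R"
    proof (rule abelian_groupI)
      fix f assume "f \<in> carrier ?R"
      then show "\<exists>g\<in>carrier ?R. g \<oplus>\<^bsub>?R\<^esub> f = \<zero>\<^bsub>?R\<^esub>"
        by (intro bexI[of _ "- f"]) (simp_all only: ops uminus left_minus)
    qed (simp_all only: ops add zero add.assoc add_0_left, rule add.commute)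
    show "Group.monoid ?R"
      by (rule monoidI) (simp_all only: ops mult one mult.assoc mult_1_left mult_1_right)
  qed (simp_all only: ops distrib_left distrib_right)
qed


section \<open>Leading monomials and Groebner bases\<close>

definition deglex :: "(nat list \<times> nat list) set" where
  "deglex = lenlex less_than"

definition LM :: "(nat list \<Rightarrow>\<^sub>0 'f::ring_1) \<Rightarrow> nat list" where
  "LM f = (THE w. w \<in> Poly_Mapping.keys f \<and> (\<forall>u\<in>Poly_Mapping.keys f. u \<noteq> w \<longrightarrow> (u, w) \<in> deglex))"

lemma LM_eqI:
  assumes "w \<in> Poly_Mapping.keys f"
    and "\<And>u. u \<in> Poly_Mapping.keys f \<Longrightarrow> u \<noteq> w \<Longrightarrow> (u, w) \<in> deglex"
  shows "LM f = w"
  unfolding LM_def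
proof (rule the_equality)
  have asym: "(v, u) \<notin> deglex" if "(u, v) \<in> deglex" for u v
    using asym_lenlex[OF asym_less_than] that unfolding deglex_def asym_on_def by auto
  fix v assume v: "v \<in> Poly_Mapping.keys f \<and> (\<forall>u\<in>Poly_Mapping.keys f. u \<noteq> v \<longrightarrow> (u, v) \<in> deglex)"
  show "v = w"
  proof (rule ccontr)
    assume "v \<noteq> w"
    then have "(v, w) \<in> deglex" "(w, v) \<in> deglex" using assms(1) assms(2)[of v] v by auto
    then show False using asym[of v w] by simp
  qed
qed (use assms in auto)

lemma LM_greatest:
  assumes "f \<noteq> 0"
  shows "LM f \<in> Poly_Mapping.keys f"
    and "u \<in> Poly_Mapping.keys f \<Longrightarrow> u \<noteq> LM f \<Longrightarrow> (u, LM f) \<in> deglex"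
proof -
  have trans: "trans deglex" unfolding deglex_def by (simp add: lenlex_transI trans_less_than)
  have total: "total deglex" unfolding deglex_def by (simp add: total_lenlex total_less_than)
  have "\<exists>w\<in>A. \<forall>u\<in>A. u \<noteq> w \<longrightarrow> (u, w) \<in> deglex" if "finite A" "A \<noteq> {}" for A
    using that
  proof (induction A rule: finite_ne_induct)
    case (insert x A)
    then obtain w where w: "w \<in> A" "\<forall>u\<in>A. u \<noteq> w \<longrightarrow> (u, w) \<in> deglex" by blast
    have "x \<noteq> w" using insert w by blast
    then consider "(x, w) \<in> deglex" | "(w, x) \<in> deglex"
      using total unfolding total_on_def by auto
    then show ?case
    proof cases
      case 1 then show ?thesis using w by auto
    next
      case 2
      have "(u, x) \<in> deglex" if "u \<in> A" for u
        using 2 w(2) that transD[OF trans, of u w x] by (cases "u = w") auto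
      then show ?thesis by auto
    qed
  qed auto
  from this[of "Poly_Mapping.keys f"] assms obtain w where
    w: "w \<in> Poly_Mapping.keys f" "\<And>u. u \<in> Poly_Mapping.keys f \<Longrightarrow> u \<noteq> w \<Longrightarrow> (u, w) \<in> deglex"
    by auto
  have eq: "LM f = w" by (rule LM_eqI) (fact w)+
  show "LM f \<in> Poly_Mapping.keys f"
    and "u \<in> Poly_Mapping.keys f \<Longrightarrow> u \<noteq> LM f \<Longrightarrow> (u, LM f) \<in> deglex"
    unfolding eq using w by simp_all
qed

definition Groebner_basis ::
  "nat set \<Rightarrow> (nat list \<Rightarrow>\<^sub>0 'f::ring_1) set \<Rightarrow> (nat list \<Rightarrow>\<^sub>0 'f) set \<Rightarrow> bool" where
  "Groebner_basis X I G \<longleftrightarrow>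
    ideal I (free_algebra X) \<and> G \<subseteq> I \<and>
    (\<forall>f\<in>I. f \<noteq> 0 \<longrightarrow> (\<exists>g\<in>G. g \<noteq> 0 \<and> sublist (LM g) (LM f)))"


section \<open>The generators\<close>

definition alt :: "'a::ring_1 list \<Rightarrow> 'a" where
  "alt zs = (\<Sum>\<sigma> | \<sigma> permutes {..<length zs}. of_int (sign \<sigma>) * prod_list (permute_list \<sigma> zs))"

definition G_gen ::
  "nat \<Rightarrow> ('l list \<Rightarrow> 'l) \<Rightarrow> (nat \<Rightarrow> 'l) \<Rightarrow> ('l \<Rightarrow> (nat list \<Rightarrow>\<^sub>0 'f::ring_1)) \<Rightarrow> nat \<Rightarrow> (nat list \<Rightarrow>\<^sub>0 'f)"
where
  "G_gen n br e \<phi> i =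
    (-1) ^ (n div 2) * (alt (map fa_var (omit n i)) - \<phi> (br (map e (omit n i))))"

end

theory Submission
  imports Defs "Jordan_Normal_Form.Determinant"
begin

text \<open>
  Every bracket \<open>[e\<^sub>1, \<dots>, e\<^sub>i omitted, \<dots>, e\<^sub>n\<^sub>+\<^sub>1]\<close> in the four cases is \<open>0\<close> or \<open>e\<^sub>i\<close>,
  so that, writing \<open>A\<^sub>i\<close> for the alternating sum over the letters other than \<open>x\<^sub>i\<close>, the generators are
  \<open>G\<^sub>i = \<plusminus>(A\<^sub>i - c\<^sub>i x\<^sub>i)\<close> with scalars \<open>c\<^sub>i\<close> and one sign \<open>\<plusminus>\<close> common to all \<open>i\<close>.
  The leading word of \<open>G\<^sub>i\<close> is the descending word \<open>w\<^sub>i\<close> in all letters other than \<open>x\<^sub>i\<close>, and the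
  common sign makes its coefficient \<open>1\<close> (\<open>lookup_alt_rev\<close>).

  By Buchberger's criterion for free algebras (\<open>Groebner_basis_of_family\<close>) it suffices to resolve the
  overlaps \<open>w\<^sub>i = a b\<close>, \<open>w\<^sub>j = b c\<close>. Both words descend and each of them lacks a single letter, which
  leaves one overlap, \<open>i = 1\<close>, \<open>j = n + 1\<close>, with \<open>a b c = x\<^sub>n\<^sub>+\<^sub>1 \<cdots> x\<^sub>1\<close> (\<open>unique_overlap\<close>).

  Expanding the alternating sum over all \<open>n + 1\<close> letters once by the first and once by the last factor
  gives, since \<open>n\<close> is even, the same signs both times. Hence \<open>\<Sum>\<^sub>i (-1)\<^sup>i\<^sup>-\<^sup>1 (x\<^sub>i A\<^sub>i - A\<^sub>i x\<^sub>i) = 0\<close>, and as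
  \<open>x\<^sub>i\<close> commutes with \<open>c\<^sub>i x\<^sub>i\<close>, also \<open>\<Sum>\<^sub>i (-1)\<^sup>i\<^sup>-\<^sup>1 (x\<^sub>i G\<^sub>i - G\<^sub>i x\<^sub>i) = 0\<close>
  (\<open>alt_generator_commutators\<close>). Solved for \<open>G\<^sub>1 x\<^sub>1 - x\<^sub>n\<^sub>+\<^sub>1 G\<^sub>n\<^sub>+\<^sub>1\<close>, this identity expresses the overlap by
  the remaining products \<open>x\<^sub>i G\<^sub>i\<close> and \<open>G\<^sub>i x\<^sub>i\<close>. Their leading words are rearrangements of
  \<open>x\<^sub>n\<^sub>+\<^sub>1 \<cdots> x\<^sub>1\<close> other than this word itself, which is the largest of its rearrangements; so
  the overlap is resolved.
\<close>

section \<open>Words in the free algebra\<close>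

abbreviation word :: "'x list \<Rightarrow> ('x list \<Rightarrow>\<^sub>0 'f::{zero,one})" where
  "word w \<equiv> Poly_Mapping.single w 1"

lemma word_mult: "word u * word v = (word (u @ v) :: 'x list \<Rightarrow>\<^sub>0 'f::ring_1)"
  by (simp add: Poly_Mapping.mult_single plus_list_def)

lemma word_Nil: "word [] = (1 :: 'x list \<Rightarrow>\<^sub>0 'f::ring_1)"
  by (metis Poly_Mapping.single_one zero_list_def)

interpretation fa: vector_space "fa_scale :: 'f::field \<Rightarrow> ('x list \<Rightarrow>\<^sub>0 'f) \<Rightarrow> _"
  by (rule vector_space_fa_scale)

lemma monomial_expansion:
  "f = (\<Sum>w\<in>Poly_Mapping.keys f. fa_scale (Poly_Mapping.lookup f w) (word w))"
  by (rule poly_mapping_eqI)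
    (simp add: Poly_Mapping.lookup_sum Poly_Mapping.lookup_single when_def in_keys_iff sum.delta'
      if_distrib[of "(*) _"] cong: if_cong)

lemma fa_scale_mult_left: "fa_scale c f * h = fa_scale c (f * h)"
  for f :: "'x list \<Rightarrow>\<^sub>0 'f::field"
  by (simp add: fa_scale_def mult_map_scale_conv_mult mult.assoc)

lemma fa_scale_central: "Poly_Mapping.single 0 c * f = f * Poly_Mapping.single 0 c"
  for f :: "'x list \<Rightarrow>\<^sub>0 'f::field"
proof -
  have "Poly_Mapping.single 0 c * fa_scale d (word w) = fa_scale d (word w) * Poly_Mapping.single 0 c"
    for d and w :: "'x list"
    by (simp add: fa_scale_def Poly_Mapping.mult_single mult.commute)
  then show ?thesis
    by (subst (1 2) monomial_expansion[of f]) (simp add: sum_distrib_left sum_distrib_right)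
qed

lemma fa_scale_mult_right: "h * fa_scale c f = fa_scale c (h * f)"
  for f :: "'x list \<Rightarrow>\<^sub>0 'f::field"
  by (metis fa_scale_central fa_scale_def mult_map_scale_conv_mult mult.assoc)

section \<open>The degree-lexicographical order\<close>

lemma deglex_wf: "wf deglex"
  unfolding deglex_def by (simp add: wf_lenlex)

lemma deglex_trans: "(u, v) \<in> deglex \<Longrightarrow> (v, w) \<in> deglex \<Longrightarrow> (u, w) \<in> deglex"
  unfolding deglex_def by (rule lenlex_trans) (auto simp: trans_less_than)

lemma deglex_irrefl: "(w, w) \<notin> deglex"
  unfolding deglex_def by (rule lenlex_irreflexive) simp

lemma deglex_linear: "(u, v) \<in> deglex \<or> u = v \<or> (v, u) \<in> deglex"
  using total_lenlex[OF total_less_than] unfolding deglex_def total_on_def by auto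

lemma deglex_context: "(u, v) \<in> deglex \<Longrightarrow> (p @ u @ q, p @ v @ q) \<in> deglex"
  unfolding deglex_def by (simp add: lenlex_append1 irrefl_def)

lemma keys_context:
  fixes f :: "'x list \<Rightarrow>\<^sub>0 'f::ring_1"
  assumes "k \<in> Poly_Mapping.keys (word u * f * word v)"
  obtains w where "w \<in> Poly_Mapping.keys f" "k = u @ w @ v"
proof -
  obtain a b where a: "a \<in> Poly_Mapping.keys (word u * f)"
    and b: "b \<in> Poly_Mapping.keys (word v :: _ \<Rightarrow>\<^sub>0 'f)" and k: "k = a + b"
    using Poly_Mapping.keys_mult[of "word u * f" "word v"] assms by blast
  obtain c w where c: "c \<in> Poly_Mapping.keys (word u :: _ \<Rightarrow>\<^sub>0 'f)"
    and w: "w \<in> Poly_Mapping.keys f" and a': "a = c + w"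
    using Poly_Mapping.keys_mult[of "word u" f] a by blast
  show thesis using that[OF w] b c k a' by (simp add: plus_list_def)
qed

section \<open>Spans of multiples of a monic family\<close>

locale monic_family =
  fixes I :: "'i set"
    and g :: "'i \<Rightarrow> (nat list \<Rightarrow>\<^sub>0 'f::field)"
    and lw :: "'i \<Rightarrow> nat list"
  assumes monic: "i \<in> I \<Longrightarrow> Poly_Mapping.lookup (g i) (lw i) = 1"
    and leading: "i \<in> I \<Longrightarrow> k \<in> Poly_Mapping.keys (g i) \<Longrightarrow> k \<noteq> lw i \<Longrightarrow> (k, lw i) \<in> deglex"
begin

definition tail :: "'i \<Rightarrow> (nat list \<Rightarrow>\<^sub>0 'f)" where
  "tail i = g i - word (lw i)"

text \<open>
  Bounding the leading words of the multiples that may occur makes it possible to say that an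
  element is a combination of multiples whose leading words are all smaller than a given word \<open>W\<close>;
  this is the sense in which an ambiguity at \<open>W\<close> is resolved.
\<close>

definition multiples :: "(nat list \<Rightarrow> bool) \<Rightarrow> (nat list \<Rightarrow>\<^sub>0 'f) set" where
  "multiples P = fa.span {word u * g i * word v | u i v. i \<in> I \<and> P (u @ lw i @ v)}"

abbreviation below :: "nat list \<Rightarrow> (nat list \<Rightarrow>\<^sub>0 'f) set" where
  "below W \<equiv> multiples (\<lambda>w. (w, W) \<in> deglex)"

lemma g_eq: "g i = word (lw i) + tail i"
  by (simp add: tail_def)

lemma keys_tail: "i \<in> I \<Longrightarrow> k \<in> Poly_Mapping.keys (tail i) \<Longrightarrow> (k, lw i) \<in> deglex"
  using leading[of i k] monic[of i]
  by (auto simp: tail_def in_keys_iff Poly_Mapping.lookup_minus Poly_Mapping.lookup_single when_def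
      split: if_splits)

lemma LM_eq: "i \<in> I \<Longrightarrow> LM (g i) = lw i"
  using monic[of i] leading[of i] by (intro LM_eqI) (auto simp: in_keys_iff)

lemma multiple_in: "i \<in> I \<Longrightarrow> P (u @ lw i @ v) \<Longrightarrow> word u * g i * word v \<in> multiples P"
  unfolding multiples_def by (rule fa.span_base) blast

lemma subspace_multiples: "fa.subspace (multiples P)"
  unfolding multiples_def by (rule fa.subspace_span)

lemmas multiples_0 = fa.subspace_0[OF subspace_multiples]
lemmas multiples_add = fa.subspace_add[OF subspace_multiples]
lemmas multiples_diff = fa.subspace_diff[OF subspace_multiples]
lemmas multiples_neg = fa.subspace_neg[OF subspace_multiples]
lemmas multiples_scale = fa.subspace_scale[OF subspace_multiples]
lemmas multiples_sum = fa.subspace_sum[OF subspace_multiples]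

lemma multiples_sign: "f \<in> multiples P \<Longrightarrow> (-1) ^ q * f \<in> multiples P"
  by (cases "even q") (simp_all add: multiples_neg)

lemma multiples_induct [consumes 1, case_names subspace multiple]:
  assumes "f \<in> multiples P" and "fa.subspace (Collect Q)"
    and "\<And>u i v. i \<in> I \<Longrightarrow> P (u @ lw i @ v) \<Longrightarrow> Q (word u * g i * word v)"
  shows "Q f"
  using assms(1) unfolding multiples_def
  by (induction rule: fa.span_induct) (use assms(2,3) in auto)

lemma multiples_mono:
  assumes "f \<in> multiples P" and "\<And>w. P w \<Longrightarrow> Q w"
  shows "f \<in> multiples Q"
  using assms fa.span_mono[of "{word u * g i * word v | u i v. i \<in> I \<and> P (u @ lw i @ v)}"
    "{word u * g i * word v | u i v. i \<in> I \<and> Q (u @ lw i @ v)}"]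
  unfolding multiples_def by blast

lemma multiples_context:
  assumes "f \<in> multiples P" and PQ: "\<And>w. P w \<Longrightarrow> Q (p @ w @ q)"
  shows "word p * f * word q \<in> multiples Q"
  using assms(1)
proof (induction rule: multiples_induct)
  case subspace
  show ?case
    by (auto intro!: fa.subspaceI
        simp: distrib_left distrib_right fa_scale_mult_left fa_scale_mult_right
          multiples_0 multiples_add multiples_scale)
next
  case (multiple u i v)
  have "word p * (word u * g i * word v) * word q = word (p @ u) * g i * word (v @ q)"
    by (simp add: word_mult[symmetric] mult.assoc)
  then show ?case using multiple PQ[of "u @ lw i @ v"] multiple_in[of i Q "p @ u" "v @ q"] by simp
qed

lemma multiple_times_poly:
  assumes "i \<in> I" and "\<And>k. k \<in> Poly_Mapping.keys h \<Longrightarrow> P (u @ lw i @ k @ v)"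
  shows "word u * g i * h * word v \<in> multiples P"
proof -
  have "word u * g i * h * word v
      = (\<Sum>k\<in>Poly_Mapping.keys h. fa_scale (Poly_Mapping.lookup h k) (word u * g i * word (k @ v)))"
    by (subst monomial_expansion[of h])
      (simp add: sum_distrib_left sum_distrib_right fa_scale_mult_left fa_scale_mult_right
        mult.assoc word_mult)
  also have "\<dots> \<in> multiples P"
    using assms by (intro multiples_sum multiples_scale multiple_in) auto
  finally show ?thesis .
qed

lemma poly_times_multiple:
  assumes "i \<in> I" and "\<And>k. k \<in> Poly_Mapping.keys h \<Longrightarrow> P (u @ k @ lw i @ v)"
  shows "word u * h * g i * word v \<in> multiples P"
proof -
  have "word u * h * g i * word v
      = (\<Sum>k\<in>Poly_Mapping.keys h. fa_scale (Poly_Mapping.lookup h k) (word (u @ k) * g i * word v))"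
    by (subst monomial_expansion[of h])
      (simp add: sum_distrib_left sum_distrib_right fa_scale_mult_left fa_scale_mult_right
        mult.assoc word_mult[symmetric])
  also have "\<dots> \<in> multiples P"
    using assms by (intro multiples_sum multiples_scale multiple_in) auto
  finally show ?thesis .
qed

text \<open>
  If both leading words occur side by side, replacing each of them by its tail in either order has the
  same effect: with \<open>g = w + t\<close>, the terms with two leading words cancel, and in what remains
  each multiple of a generator has a tail in place of the other leading word.
\<close>

lemma disjoint_resolvable:
  assumes i: "i \<in> I" and j: "j \<in> I"
  shows "g i * word (m @ lw j) - word (lw i @ m) * g j \<in> below (lw i @ m @ lw j)"
proof -
  have "g i * word (m @ lw j) - word (lw i @ m) * g j
      = word [] * (tail i * word m) * g j * word [] - word [] * g i * (word m * tail j) * word []"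
    by (simp add: g_eq[of i] g_eq[of j] word_Nil word_mult[symmetric] algebra_simps)
  also have "\<dots> \<in> below (lw i @ m @ lw j)"
  proof (rule multiples_diff)
    show "word [] * (tail i * word m) * g j * word [] \<in> below (lw i @ m @ lw j)"
    proof (rule poly_times_multiple[OF j])
      fix k assume "k \<in> Poly_Mapping.keys (tail i * word m)"
      then have "k \<in> Poly_Mapping.keys (word [] * tail i * word m)" by (simp add: word_Nil)
      then obtain w where "w \<in> Poly_Mapping.keys (tail i)" "k = [] @ w @ m" by (rule keys_context)
      then show "([] @ k @ lw j @ [], lw i @ m @ lw j) \<in> deglex"
        using deglex_context[OF keys_tail[OF i], of w "[]" "m @ lw j"] by simp
    qed
    show "word [] * g i * (word m * tail j) * word [] \<in> below (lw i @ m @ lw j)"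
    proof (rule multiple_times_poly[OF i])
      fix k assume "k \<in> Poly_Mapping.keys (word m * tail j)"
      then have "k \<in> Poly_Mapping.keys (word m * tail j * word [])" by (simp add: word_Nil)
      then obtain w where "w \<in> Poly_Mapping.keys (tail j)" "k = m @ w @ []" by (rule keys_context)
      then show "([] @ lw i @ k @ [], lw i @ m @ lw j) \<in> deglex"
        using deglex_context[OF keys_tail[OF j], of w "lw i @ m" "[]"] by simp
    qed
  qed
  finally show ?thesis .
qed

lemma keys_below:
  assumes "f \<in> below W" and "k \<in> Poly_Mapping.keys f"
  shows "(k, W) \<in> deglex"
proof -
  have "\<forall>k\<in>Poly_Mapping.keys f. (k, W) \<in> deglex" using assms(1)
  proof (induction rule: multiples_induct)
    case subspace
    show ?case
    proof (rule fa.subspaceI)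
      fix x y :: "nat list \<Rightarrow>\<^sub>0 'f" and c
      assume x: "x \<in> {f. \<forall>k\<in>Poly_Mapping.keys f. (k, W) \<in> deglex}"
      show "fa_scale c x \<in> {f. \<forall>k\<in>Poly_Mapping.keys f. (k, W) \<in> deglex}"
        using x by (auto simp: in_keys_iff)
      assume "y \<in> {f. \<forall>k\<in>Poly_Mapping.keys f. (k, W) \<in> deglex}"
      with x show "x + y \<in> {f. \<forall>k\<in>Poly_Mapping.keys f. (k, W) \<in> deglex}"
        using Poly_Mapping.keys_add[of x y] by auto
    qed simp
  next
    case (multiple u i v)
    show ?case
    proof
      fix k assume "k \<in> Poly_Mapping.keys (word u * g i * word v)"
      then obtain w where w: "w \<in> Poly_Mapping.keys (g i)" "k = u @ w @ v" by (rule keys_context)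
      then show "(k, W) \<in> deglex"
        using multiple deglex_trans[OF deglex_context[OF leading[OF multiple(1), of w]]]
        by (cases "w = lw i") auto
    qed
  qed
  then show ?thesis using assms(2) by blast
qed

lemma multiple_minus_word:
  assumes "i \<in> I" and "k \<in> Poly_Mapping.keys (word u * g i * word v - word (u @ lw i @ v))"
  shows "(k, u @ lw i @ v) \<in> deglex"
proof -
  have "word u * g i * word v - word (u @ lw i @ v) = word u * tail i * word v"
    by (simp add: tail_def word_mult[symmetric] algebra_simps)
  then show ?thesis
    using assms keys_context[of k u "tail i" v] keys_tail[of i] deglex_context by metis
qed

text \<open>
  A combination of finitely many multiples has a largest leading word among them. Stated for membership
  in a span, without choosing a combination, this is what the descent on leading words runs on.
\<close>

lemma multiples_bound:
  assumes "f \<in> multiples P" and "f \<noteq> 0"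
  shows "\<exists>W. P W \<and> f \<in> multiples (\<lambda>w. (w, W) \<in> deglex\<^sup>=)"
proof -
  let ?Q = "\<lambda>f. f = 0 \<or> (\<exists>W. P W \<and> f \<in> multiples (\<lambda>w. (w, W) \<in> deglex\<^sup>=))"
  have "?Q f" using assms(1)
  proof (induction rule: multiples_induct)
    case subspace
    have *: "multiples (\<lambda>w. (w, W) \<in> deglex\<^sup>=) \<subseteq> multiples (\<lambda>w. (w, W') \<in> deglex\<^sup>=)"
      if "(W, W') \<in> deglex" for W W'
      by (rule subsetI, erule multiples_mono) (use that deglex_trans in auto)
    show ?case
    proof (rule fa.subspaceI)
      fix x y and c :: 'f
      assume x: "x \<in> Collect ?Q"
      then show "fa_scale c x \<in> Collect ?Q" by (auto intro: multiples_scale)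
      assume y: "y \<in> Collect ?Q"
      show "x + y \<in> Collect ?Q"
      proof (cases "x = 0 \<or> y = 0")
        case True
        then show ?thesis using x y by auto
      next
        case False
        then obtain U V where UV: "P U" "x \<in> multiples (\<lambda>w. (w, U) \<in> deglex\<^sup>=)"
          "P V" "y \<in> multiples (\<lambda>w. (w, V) \<in> deglex\<^sup>=)" using x y by blast
        have "x + y \<in> multiples (\<lambda>w. (w, U) \<in> deglex\<^sup>=) \<or> x + y \<in> multiples (\<lambda>w. (w, V) \<in> deglex\<^sup>=)"
          using deglex_linear[of U V]
        proof (elim disjE)
          assume "(V, U) \<in> deglex"
          then show ?thesis using multiples_add[OF UV(2)] *[of V U] UV(4) by blast
        next
          assume "(U, V) \<in> deglex"
          then show ?thesis using multiples_add[OF _ UV(4)] *[of U V] UV(2) by blast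
        qed (use multiples_add[OF UV(2)] UV(4) in simp)
        then show ?thesis using UV by blast
      qed
    qed simp
  next
    case (multiple u i v)
    then have "word u * g i * word v \<in> multiples (\<lambda>w. (w, u @ lw i @ v) \<in> deglex\<^sup>=)"
      by (intro multiple_in) auto
    then show ?case using multiple by blast
  qed
  then show ?thesis using assms(2) by blast
qed

end

section \<open>Buchberger's criterion\<close>

text \<open>
  No leading word is a factor of another one, so besides disjoint occurrences there are only proper
  overlaps, and the difference in the last assumption is what its two reductions at \<open>a @ b @ c\<close> disagree by.
\<close>

locale resolvable_family = monic_family I g lw
  for I :: "'i set"
    and g :: "'i \<Rightarrow> (nat list \<Rightarrow>\<^sub>0 'f::field)"
    and lw :: "'i \<Rightarrow> nat list" +
  assumes no_inclusion: "i \<in> I \<Longrightarrow> j \<in> I \<Longrightarrow> sublist (lw i) (lw j) \<Longrightarrow> i = j"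
    and overlap: "i \<in> I \<Longrightarrow> j \<in> I \<Longrightarrow> lw i = a @ b \<Longrightarrow> lw j = b @ c \<Longrightarrow>
      a \<noteq> [] \<Longrightarrow> b \<noteq> [] \<Longrightarrow> c \<noteq> [] \<Longrightarrow> g i * word c - word a * g j \<in> below (a @ b @ c)"
begin

text \<open>
  The second leading word starts behind \<open>s\<close>. Either it starts behind the end of the first one, or
  the two overlap, or one contains the other, in which case they are the same occurrence.
\<close>

lemma reducts_agree_shifted:
  assumes i: "i \<in> I" and j: "j \<in> I" and eq: "lw i @ v = s @ lw j @ v'"
  shows "g i * word v - word s * g j * word v' \<in> below (lw i @ v)"
proof -
  from eq consider (inside) t where "lw i = s @ t" "t @ v = lw j @ v'"
    | (disjoint) m where "s = lw i @ m" "v = m @ lw j @ v'"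
    by (metis append_eq_append_conv2)
  then show ?thesis
  proof cases
    case disjoint
    have "g i * word v - word s * g j * word v'
        = word [] * (g i * word (m @ lw j) - word (lw i @ m) * g j) * word v'"
      by (simp add: disjoint word_Nil word_mult[symmetric] algebra_simps)
    moreover have "\<dots> \<in> below (lw i @ v)"
      by (rule multiples_context[OF disjoint_resolvable[OF i j]])
        (use disjoint deglex_context[of _ "lw i @ m @ lw j" "[]" v'] in auto)
    ultimately show ?thesis by simp
  next
    case inside
    have same: ?thesis if "i = j" "s = []"
      using eq that by (simp add: word_Nil multiples_0)
    from inside(2) consider r where "t = lw j @ r" | c where "lw j = t @ c" "v = c @ v'"
      by (metis append_eq_append_conv2)
    then show ?thesis
    proof cases
      case 1
      then have "sublist (lw j) (lw i)" using inside(1) by (auto simp: sublist_def)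
      then have "i = j" using no_inclusion[OF j i] by simp
      moreover from this have "s = []" using arg_cong[OF inside(1), of length] 1 by simp
      ultimately show ?thesis by (rule same)
    next
      case c: 2
      consider "t = []" | "s = []" | "c = []" | "t \<noteq> []" "s \<noteq> []" "c \<noteq> []" by blast
      then show ?thesis
      proof cases
        case 1
        have "g i * word v - word s * g j * word v'
            = word [] * (g i * word ([] @ lw j) - word (lw i @ []) * g j) * word v'"
          using 1 c inside by (simp add: word_Nil word_mult[symmetric] algebra_simps)
        moreover have "\<dots> \<in> below (lw i @ v)"
          by (rule multiples_context[OF disjoint_resolvable[OF i j]])
            (use 1 c inside deglex_context[of _ "lw i @ [] @ lw j" "[]" v'] in auto)
        ultimately show ?thesis by simp
      next
        case 2
        then have "sublist (lw i) (lw j)" using c inside(1) by (metis append_Nil sublist_def)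
        then show ?thesis using same 2 no_inclusion[OF i j] by simp
      next
        case 3
        then have "sublist (lw j) (lw i)" using c inside(1) by (metis append_Nil2 sublist_def)
        then have "i = j" using no_inclusion[OF j i] by simp
        moreover from this have "s = []" using inside(1) c(1) 3 by simp
        ultimately show ?thesis by (rule same)
      next
        case 4
        have "g i * word v - word s * g j * word v'
            = word [] * (g i * word c - word s * g j) * word v'"
          by (simp add: c word_Nil word_mult[symmetric] algebra_simps)
        moreover have "\<dots> \<in> below (lw i @ v)"
          by (rule multiples_context[OF overlap[OF i j inside(1) c(1) 4(2,1,3)]])
            (use c inside deglex_context[of _ "s @ t @ c" "[]" v'] in auto)
        ultimately show ?thesis by simp
      qed
    qed
  qed
qed

lemma reducts_agree:
  assumes i: "i \<in> I" and j: "j \<in> I" and eq: "u @ lw i @ v = u' @ lw j @ v'"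
  shows "word u * g i * word v - word u' * g j * word v' \<in> below (u @ lw i @ v)"
proof -
  have main: "word u * g i * word v - word u' * g j * word v' \<in> below (u @ lw i @ v)"
    if ij: "i \<in> I" "j \<in> I" and u': "u' = u @ s" and e: "lw i @ v = s @ lw j @ v'" for i j u u' v v' s
  proof -
    have "word u * g i * word v - word u' * g j * word v'
        = word u * (g i * word v - word s * g j * word v') * word []"
      by (simp add: u' word_Nil word_mult[symmetric] algebra_simps)
    moreover have "\<dots> \<in> below (u @ lw i @ v)"
      by (rule multiples_context[OF reducts_agree_shifted[OF ij e]])
        (use deglex_context[of _ "lw i @ v" u "[]"] in auto)
    ultimately show ?thesis by simp
  qed
  obtain s where "u = u' @ s \<and> s @ lw i @ v = lw j @ v' \<or> u @ s = u' \<and> lw i @ v = s @ lw j @ v'"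
    using iffD1[OF append_eq_append_conv2 eq] by blast
  then consider "u' = u @ s" "lw i @ v = s @ lw j @ v'" | "u = u' @ s" "lw j @ v' = s @ lw i @ v"
    by metis
  then show ?thesis
  proof cases
    case 1
    then show ?thesis by (rule main[OF i j])
  next
    case 2
    then have "- (word u' * g j * word v' - word u * g i * word v) \<in> below (u' @ lw j @ v')"
      by (intro multiples_neg main[OF j i])
    then show ?thesis by (simp add: eq)
  qed
qed

text \<open>
  Choose the bound \<open>W\<close> on the leading words of the multiples that combine to \<open>f\<close> as small as possible.
  All multiples with leading word \<open>W\<close> agree modulo smaller ones (\<open>reducts_agree\<close>), so \<open>f\<close> is one scalar
  times one such multiple plus smaller ones. By minimality the scalar is nonzero, hence nothing can
  cancel \<open>W\<close>, and \<open>W\<close> is the leading word of \<open>f\<close>.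
\<close>

theorem leading_word_reducible:
  assumes "f \<in> multiples (\<lambda>_. True)" and "f \<noteq> 0"
  shows "\<exists>i\<in>I. sublist (lw i) (LM f)"
proof -
  let ?A = "{W. f \<in> multiples (\<lambda>w. (w, W) \<in> deglex\<^sup>=)}"
  from multiples_bound[OF assms] obtain W0 where "W0 \<in> ?A" by blast
  then obtain W where W: "W \<in> ?A" and min: "\<And>V. (V, W) \<in> deglex \<Longrightarrow> V \<notin> ?A"
    by (rule wfE_min[OF deglex_wf]) blast
  have not_below: "f \<notin> below W"
    using multiples_bound[of f "\<lambda>w. (w, W) \<in> deglex"] assms(2) min by blast
  obtain u i v where i: "i \<in> I" and Weq: "u @ lw i @ v = W"
  proof (rule ccontr)
    assume "\<not> thesis"
    then have "{word u * g i * word v | u i v. i \<in> I \<and> (u @ lw i @ v, W) \<in> deglex\<^sup>=}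
        = {word u * g i * word v | u i v. i \<in> I \<and> (u @ lw i @ v, W) \<in> deglex}"
      using that by blast
    then show False using W not_below by (simp add: multiples_def)
  qed
  let ?g = "word u * g i * word v"
  let ?S = "{word u * g i * word v | u i v. i \<in> I \<and> (u @ lw i @ v, W) \<in> deglex}"
  have "{word u * g i * word v | u i v. i \<in> I \<and> (u @ lw i @ v, W) \<in> deglex\<^sup>=}
      \<subseteq> fa.span (insert ?g ?S)"
  proof clarify
    fix u' j v' assume j: "j \<in> I" and le: "(u' @ lw j @ v', W) \<in> deglex\<^sup>="
    show "word u' * g j * word v' \<in> fa.span (insert ?g ?S)"
    proof (cases "u' @ lw j @ v' = W")
      case True
      then have "word u' * g j * word v' - ?g \<in> fa.span ?S"
        using reducts_agree[OF j i, of u' v' u v] Weq by (simp add: multiples_def)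
      then have "word u' * g j * word v' - fa_scale 1 ?g \<in> fa.span ?S" by simp
      then show ?thesis unfolding fa.span_breakdown_eq by blast
    next
      case False
      then show ?thesis using j le by (intro fa.span_base) blast
    qed
  qed
  then have "multiples (\<lambda>w. (w, W) \<in> deglex\<^sup>=) \<subseteq> fa.span (insert ?g ?S)"
    unfolding multiples_def by (rule fa.span_minimal) simp
  then have "f \<in> fa.span (insert ?g ?S)" using W by auto
  then obtain c where c: "f - fa_scale c ?g \<in> below W"
    unfolding multiples_def fa.span_breakdown_eq[of f] by (elim exE)
  have "c \<noteq> 0" using c not_below by auto
  have coeff: "Poly_Mapping.lookup ?g W = 1"
    using multiple_minus_word[OF i, of W u v] Weq deglex_irrefl
    by (auto simp: in_keys_iff Poly_Mapping.lookup_minus)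
  have "LM f = W"
  proof (rule LM_eqI)
    have "Poly_Mapping.lookup (f - fa_scale c ?g) W = 0"
      using keys_below[OF c, of W] deglex_irrefl by (auto simp: in_keys_iff)
    then show "W \<in> Poly_Mapping.keys f"
      using coeff \<open>c \<noteq> 0\<close> by (simp add: in_keys_iff Poly_Mapping.lookup_minus)
  next
    fix k assume k: "k \<in> Poly_Mapping.keys f" "k \<noteq> W"
    show "(k, W) \<in> deglex"
    proof (rule ccontr)
      assume n: "(k, W) \<notin> deglex"
      have "Poly_Mapping.lookup (f - fa_scale c ?g) k = 0"
        using keys_below[OF c, of k] n by (auto simp: in_keys_iff)
      moreover have "Poly_Mapping.lookup ?g k = 0"
        using multiple_minus_word[OF i, of k u v] Weq n k(2)
        by (auto simp: in_keys_iff Poly_Mapping.lookup_minus Poly_Mapping.lookup_single when_def)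
      ultimately show False using k by (simp add: in_keys_iff Poly_Mapping.lookup_minus)
    qed
  qed
  then have "sublist (lw i) (LM f)" unfolding sublist_def using Weq by metis
  then show ?thesis using i by blast
qed

lemma ideal_multiples:
  "ideal (multiples (\<lambda>_. True) \<inter> carrier (free_algebra X)) (free_algebra X)"
proof -
  let ?R = "free_algebra X :: (nat list \<Rightarrow>\<^sub>0 'f) ring"
  let ?J = "multiples (\<lambda>_. True) \<inter> carrier ?R"
  interpret R: Ring.ring ?R by (rule ring_free_algebra)
  have ops: "f \<oplus>\<^bsub>?R\<^esub> h = f + h" "f \<otimes>\<^bsub>?R\<^esub> h = f * h" "\<zero>\<^bsub>?R\<^esub> = 0" for f h
    by (simp_all add: free_algebra_def)
  have lr: "h * f \<in> multiples (\<lambda>_. True) \<and> f * h \<in> multiples (\<lambda>_. True)"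
    if f: "f \<in> multiples (\<lambda>_. True)" for f h
  proof -
    have "h * f = (\<Sum>k\<in>Poly_Mapping.keys h. fa_scale (Poly_Mapping.lookup h k) (word k * f * word []))"
      by (subst monomial_expansion[of h]) (simp add: sum_distrib_right fa_scale_mult_left word_Nil)
    moreover have
      "f * h = (\<Sum>k\<in>Poly_Mapping.keys h. fa_scale (Poly_Mapping.lookup h k) (word [] * f * word k))"
      by (subst monomial_expansion[of h]) (simp add: sum_distrib_left fa_scale_mult_right word_Nil)
    ultimately show ?thesis
      using multiples_context[OF f, of "\<lambda>_. True"] by (simp add: multiples_sum multiples_scale)
  qed
  have minus: "\<ominus>\<^bsub>?R\<^esub> f = - f" if "f \<in> carrier ?R" for f
  proof (rule R.minus_equality)
    show "- f \<in> carrier ?R" using that by (auto simp: free_algebra_def)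
  qed (use that ops in simp_all)
  show ?thesis
  proof (rule idealI)
    show "Ring.ring ?R" by (rule R.ring_axioms)
    show "subgroup ?J (add_monoid ?R)"
    proof (rule R.add.subgroupI)
      show "?J \<noteq> {}" using IntI[OF multiples_0 R.zero_closed[unfolded ops]] by blast
      show "\<ominus>\<^bsub>?R\<^esub> f \<in> ?J" if "f \<in> ?J" for f
        using that minus[of f] R.a_inv_closed[of f] by (auto intro: multiples_neg)
      show "f \<oplus>\<^bsub>?R\<^esub> h \<in> ?J" if "f \<in> ?J" "h \<in> ?J" for f h
        using that R.a_closed[of f h] by (auto simp: ops intro: multiples_add)
    qed simp
    fix a x assume "a \<in> ?J" "x \<in> carrier ?R"
    then show "x \<otimes>\<^bsub>?R\<^esub> a \<in> ?J" "a \<otimes>\<^bsub>?R\<^esub> x \<in> ?J"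
      using lr[of a x] R.m_closed[of a x] R.m_closed[of x a] by (auto simp: ops)
  qed
qed

theorem Groebner_basis_of_family:
  assumes X: "g ` I \<subseteq> carrier (free_algebra X)"
  shows "Groebner_basis X (Idl\<^bsub>free_algebra X\<^esub> (g ` I)) (g ` I)"
proof -
  interpret R: Ring.ring "free_algebra X :: (nat list \<Rightarrow>\<^sub>0 'f) ring" by (rule ring_free_algebra)
  have "g i \<in> multiples (\<lambda>_. True)" if "i \<in> I" for i
    using multiple_in[OF that, of "\<lambda>_. True" "[]" "[]"] by (simp add: word_Nil)
  then have sub: "Idl\<^bsub>free_algebra X\<^esub> (g ` I) \<subseteq> multiples (\<lambda>_. True)"
    using R.genideal_minimal[OF ideal_multiples[of X], of "g ` I"] X by blast
  show ?thesis
    unfolding Groebner_basis_def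
  proof (intro conjI ballI impI)
    show "ideal (Idl\<^bsub>free_algebra X\<^esub> (g ` I)) (free_algebra X)" by (rule R.genideal_ideal[OF X])
    show "g ` I \<subseteq> Idl\<^bsub>free_algebra X\<^esub> (g ` I)" by (rule R.genideal_self[OF X])
    fix f assume "f \<in> Idl\<^bsub>free_algebra X\<^esub> (g ` I)" "f \<noteq> 0"
    then obtain i where i: "i \<in> I" "sublist (lw i) (LM f)" using leading_word_reducible sub by blast
    moreover have "g i \<noteq> 0" using monic[OF i(1)] by auto
    ultimately show "\<exists>h\<in>g ` I. h \<noteq> 0 \<and> sublist (LM h) (LM f)" using LM_eq[OF i(1)] by auto
  qed
qed

end

section \<open>Alternating sums of letters\<close>

lemma lookup_letter_times:
  fixes f :: "'x list \<Rightarrow>\<^sub>0 'f::field"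
  shows "Poly_Mapping.lookup (fa_var x * f) [] = 0"
    and "Poly_Mapping.lookup (fa_var x * f) (y # w) = (if y = x then Poly_Mapping.lookup f w else 0)"
proof -
  have "fa_var x * f
      = (\<Sum>k\<in>Poly_Mapping.keys f. fa_scale (Poly_Mapping.lookup f k) (word (x # k)))"
    by (subst monomial_expansion[of f])
      (simp add: fa_var_def sum_distrib_left fa_scale_mult_right word_mult)
  then have *: "Poly_Mapping.lookup (fa_var x * f) W
      = (\<Sum>k\<in>Poly_Mapping.keys f. if x # k = W then Poly_Mapping.lookup f k else 0)" for W
    by (simp add: Poly_Mapping.lookup_sum Poly_Mapping.lookup_single when_def if_distrib[of "(*) _"]
        cong: if_cong)
  show "Poly_Mapping.lookup (fa_var x * f) [] = 0" unfolding * by simp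
  show "Poly_Mapping.lookup (fa_var x * f) (y # w) = (if y = x then Poly_Mapping.lookup f w else 0)"
    unfolding * by (auto simp: sum.delta in_keys_iff)
qed

lemma lookup_times_letter:
  fixes f :: "'x list \<Rightarrow>\<^sub>0 'f::field"
  shows "Poly_Mapping.lookup (f * fa_var x) [] = 0"
    and "Poly_Mapping.lookup (f * fa_var x) (w @ [y]) = (if y = x then Poly_Mapping.lookup f w else 0)"
proof -
  have "f * fa_var x
      = (\<Sum>k\<in>Poly_Mapping.keys f. fa_scale (Poly_Mapping.lookup f k) (word (k @ [x])))"
    by (subst monomial_expansion[of f])
      (simp add: fa_var_def sum_distrib_right fa_scale_mult_left word_mult)
  then have *: "Poly_Mapping.lookup (f * fa_var x) W
      = (\<Sum>k\<in>Poly_Mapping.keys f. if k @ [x] = W then Poly_Mapping.lookup f k else 0)" for W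
    by (simp add: Poly_Mapping.lookup_sum Poly_Mapping.lookup_single when_def if_distrib[of "(*) _"]
        cong: if_cong)
  show "Poly_Mapping.lookup (f * fa_var x) [] = 0" unfolding * by simp
  show "Poly_Mapping.lookup (f * fa_var x) (w @ [y]) = (if y = x then Poly_Mapping.lookup f w else 0)"
    unfolding * by (auto simp: sum.delta in_keys_iff)
qed

lemma lookup_sign_times:
  "Poly_Mapping.lookup ((-1) ^ k * f) w = (-1) ^ k * Poly_Mapping.lookup f w"
  for f :: "'x list \<Rightarrow>\<^sub>0 'f::field"
  by (cases "even k") auto

lemma prod_list_letters: "prod_list (map fa_var w) = (word w :: 'x list \<Rightarrow>\<^sub>0 'f::field)"
  by (induction w) (simp_all add: word_Nil fa_var_def word_mult)

lemma alt_letters: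
  "alt (map fa_var xs) = (\<Sum>\<sigma> | \<sigma> permutes {..<length xs}.
     fa_scale (of_int (sign \<sigma>)) (word (permute_list \<sigma> xs)) :: 'x list \<Rightarrow>\<^sub>0 'f::field)"
  unfolding alt_def
proof (rule sum.cong)
  fix \<sigma> assume "\<sigma> \<in> {\<sigma>. \<sigma> permutes {..<length xs}}"
  then have "of_int (sign \<sigma>) * prod_list (permute_list \<sigma> (map fa_var xs))
      = (of_int (sign \<sigma>) * word (permute_list \<sigma> xs) :: 'x list \<Rightarrow>\<^sub>0 'f)"
    by (simp add: permute_list_map prod_list_letters)
  also have "\<dots> = fa_scale (of_int (sign \<sigma>)) (word (permute_list \<sigma> xs))"
    by (cases \<sigma> rule: sign_cases) (auto intro!: poly_mapping_eqI)
  finally show "of_int (sign \<sigma>) * prod_list (permute_list \<sigma> (map fa_var xs))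
      = (fa_scale (of_int (sign \<sigma>)) (word (permute_list \<sigma> xs)) :: 'x list \<Rightarrow>\<^sub>0 'f)" .
qed simp

lemma keys_alt_letters:
  assumes "w \<in> Poly_Mapping.keys (alt (map fa_var xs) :: 'x list \<Rightarrow>\<^sub>0 'f::field)"
  shows "mset w = mset xs"
proof -
  obtain \<sigma> where \<sigma>: "\<sigma> permutes {..<length xs}"
    and "w \<in> Poly_Mapping.keys (fa_scale (of_int (sign \<sigma>)) (word (permute_list \<sigma> xs)) :: _ \<Rightarrow>\<^sub>0 'f)"
    using assms Poly_Mapping.keys_sum unfolding alt_letters by fast
  then have "w = permute_list \<sigma> xs"
    by (auto simp: in_keys_iff Poly_Mapping.lookup_single when_def split: if_splits)
  then show ?thesis using \<sigma> by simp
qed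

text \<open>
  By the Leibniz formula the coefficient of a word in an alternating sum of letters is the
  determinant of this matrix, so Laplace expansion of determinants becomes an expansion of
  alternating sums in noncommuting letters.
\<close>

definition incidence :: "'x list \<Rightarrow> 'x list \<Rightarrow> 'f::field mat" where
  "incidence w xs = mat (length xs) (length xs) (\<lambda>(p, q). if w ! p = xs ! q then 1 else 0)"

lemma lookup_alt_letters:
  assumes len: "length w = length xs"
  shows "Poly_Mapping.lookup (alt (map fa_var xs)) w = (det (incidence w xs) :: 'f::field)"
proof -
  let ?m = "length xs"
  have "(of_int (sign \<sigma>) * (if permute_list \<sigma> xs = w then 1 else 0) :: 'f)
      = of_int (sign \<sigma>) * (\<Prod>p = 0..<?m. incidence w xs $$ (p, \<sigma> p))"
    if \<sigma>: "\<sigma> permutes {0..<?m}" for \<sigma>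
  proof -
    have lt: "\<sigma> p < ?m" if "p < ?m" for p using permutes_in_image[OF \<sigma>, of p] that by simp
    have "(\<Prod>p = 0..<?m. incidence w xs $$ (p, \<sigma> p))
        = (\<Prod>p = 0..<?m. if w ! p = xs ! \<sigma> p then 1 else 0 :: 'f)"
      by (rule prod.cong) (use lt in \<open>auto simp: incidence_def\<close>)
    also have "\<dots> = (if \<forall>p<?m. w ! p = xs ! \<sigma> p then 1 else 0)"
      by (cases "\<forall>p<?m. w ! p = xs ! \<sigma> p") (auto simp: prod_zero_iff)
    also have "(\<forall>p<?m. w ! p = xs ! \<sigma> p) \<longleftrightarrow> permute_list \<sigma> xs = w"
      using len permute_list_nth[OF \<sigma>[folded lessThan_atLeast0]]
      by (auto simp: list_eq_iff_nth_eq[of "permute_list \<sigma> xs"])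
    finally show ?thesis by simp
  qed
  then show ?thesis
    unfolding alt_letters det_def
    by (auto simp: Poly_Mapping.lookup_sum Poly_Mapping.lookup_single when_def incidence_def
        lessThan_atLeast0 intro!: sum.cong)
qed

lemma lookup_alt_letters_length:
  "length w \<noteq> length xs \<Longrightarrow> Poly_Mapping.lookup (alt (map fa_var xs)) w = (0 :: 'f::field)"
  using keys_alt_letters[of w xs, where 'f = 'f] by (metis in_keys_iff size_mset)

definition delete_nth :: "nat \<Rightarrow> 'x list \<Rightarrow> 'x list" where
  "delete_nth q xs = take q xs @ drop (Suc q) xs"

lemma delete_nth_simps:
  "q < length xs \<Longrightarrow> length (delete_nth q xs) = length xs - 1"
  "q < length xs \<Longrightarrow> p < length xs - 1 \<Longrightarrow>
    delete_nth q xs ! p = xs ! (if p < q then p else Suc p)"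
  by (auto simp: delete_nth_def nth_append min_def)

text \<open>
  Coefficient by coefficient, this is Laplace expansion along the first row of the incidence matrix;
  the expansion along the last row gives the analogue for the last factor.
\<close>

lemma alt_expand_first:
  assumes xs: "xs \<noteq> []"
  shows "alt (map fa_var xs) = (\<Sum>q<length xs.
    (-1) ^ q * (fa_var (xs ! q) * alt (map fa_var (delete_nth q xs))) :: 'x list \<Rightarrow>\<^sub>0 'f::field)"
    (is "_ = ?R")
proof (rule poly_mapping_eqI)
  fix W
  show "Poly_Mapping.lookup (alt (map fa_var xs) :: 'x list \<Rightarrow>\<^sub>0 'f) W = Poly_Mapping.lookup ?R W"
  proof (cases W)
    case Nil
    then show ?thesis
      using xs by (simp add: lookup_alt_letters_length Poly_Mapping.lookup_sum lookup_sign_times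
          lookup_letter_times)
  next
    case (Cons y w)
    show ?thesis
    proof (cases "length W = length xs")
      case False
      then show ?thesis
        using Cons by (auto simp: lookup_alt_letters_length Poly_Mapping.lookup_sum lookup_sign_times
            lookup_letter_times delete_nth_simps intro!: sum.neutral)
    next
      case True
      let ?A = "incidence W xs :: 'f mat"
      have A: "?A \<in> carrier_mat (length xs) (length xs)" by (simp add: incidence_def)
      have del: "mat_delete ?A 0 q = incidence w (delete_nth q xs)" if "q < length xs" for q
        by (rule eq_matI) (use that Cons in \<open>auto simp: mat_delete_def incidence_def delete_nth_simps\<close>)
      have "Poly_Mapping.lookup (alt (map fa_var xs)) W
          = (\<Sum>q<length xs. ?A $$ (0, q) * cofactor ?A 0 q)"
        unfolding lookup_alt_letters[OF True] by (rule laplace_expansion_row[OF A]) (use xs in simp)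
      also have "\<dots> = Poly_Mapping.lookup ?R W"
        unfolding Poly_Mapping.lookup_sum lookup_sign_times
      proof (rule sum.cong)
        fix q assume q: "q \<in> {..<length xs}"
        then have "length w = length (delete_nth q xs)"
          using True Cons by (simp add: delete_nth_simps)
        then have "Poly_Mapping.lookup (fa_var (xs ! q) * alt (map fa_var (delete_nth q xs))) W
            = (if y = xs ! q then det (incidence w (delete_nth q xs)) else (0 :: 'f))"
          by (simp add: Cons lookup_letter_times lookup_alt_letters)
        moreover have "?A $$ (0, q) = (if y = xs ! q then 1 else 0)"
          using q Cons xs by (auto simp: incidence_def)
        moreover have "cofactor ?A 0 q = (-1) ^ q * det (incidence w (delete_nth q xs))"
          using q by (simp add: cofactor_def del)
        ultimately show "?A $$ (0, q) * cofactor ?A 0 q = (-1) ^ q *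
            Poly_Mapping.lookup (fa_var (xs ! q) * alt (map fa_var (delete_nth q xs))) W"
          by (simp only:) simp
      qed simp
      finally show ?thesis .
    qed
  qed
qed

lemma alt_expand_last:
  assumes xs: "length xs = Suc m"
  shows "alt (map fa_var xs) = (\<Sum>q<length xs.
    (-1) ^ (m + q) * (alt (map fa_var (delete_nth q xs)) * fa_var (xs ! q)) :: 'x list \<Rightarrow>\<^sub>0 'f::field)"
    (is "_ = ?R")
proof (rule poly_mapping_eqI)
  fix W
  show "Poly_Mapping.lookup (alt (map fa_var xs) :: 'x list \<Rightarrow>\<^sub>0 'f) W = Poly_Mapping.lookup ?R W"
  proof (cases W rule: rev_cases)
    case Nil
    then show ?thesis
      using xs by (simp add: lookup_alt_letters_length Poly_Mapping.lookup_sum lookup_sign_times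
          lookup_times_letter del: sum.lessThan_Suc)
  next
    case (snoc w y)
    show ?thesis
    proof (cases "length W = length xs")
      case False
      then show ?thesis
        using snoc by (auto simp: lookup_alt_letters_length Poly_Mapping.lookup_sum lookup_sign_times
            lookup_times_letter delete_nth_simps intro!: sum.neutral)
    next
      case True
      let ?A = "incidence W xs :: 'f mat"
      have A: "?A \<in> carrier_mat (length xs) (length xs)" by (simp add: incidence_def)
      have del: "mat_delete ?A m q = incidence w (delete_nth q xs)" if "q < length xs" for q
        by (rule eq_matI) (use that snoc xs True in
          \<open>auto simp: mat_delete_def incidence_def delete_nth_simps nth_append\<close>)
      have "Poly_Mapping.lookup (alt (map fa_var xs)) W
          = (\<Sum>q<length xs. ?A $$ (m, q) * cofactor ?A m q)"
        unfolding lookup_alt_letters[OF True] by (rule laplace_expansion_row[OF A]) (use xs in simp)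
      also have "\<dots> = Poly_Mapping.lookup ?R W"
        unfolding Poly_Mapping.lookup_sum lookup_sign_times
      proof (rule sum.cong)
        fix q assume q: "q \<in> {..<length xs}"
        then have len: "length w = length (delete_nth q xs)" "length w = m"
          using True snoc xs by (simp_all add: delete_nth_simps)
        have "Poly_Mapping.lookup (alt (map fa_var (delete_nth q xs)) * fa_var (xs ! q)) W
            = (if y = xs ! q then det (incidence w (delete_nth q xs)) else (0 :: 'f))"
          by (simp add: snoc lookup_times_letter lookup_alt_letters len(1))
        moreover have "?A $$ (m, q) = (if y = xs ! q then 1 else 0)"
          using q snoc xs len(2) by (auto simp: incidence_def)
        moreover have "cofactor ?A m q = (-1) ^ (m + q) * det (incidence w (delete_nth q xs))"
          using q by (simp add: cofactor_def del)
        ultimately show "?A $$ (m, q) * cofactor ?A m q = (-1) ^ (m + q) *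
            Poly_Mapping.lookup (alt (map fa_var (delete_nth q xs)) * fa_var (xs ! q)) W"
          by (simp only:) simp
      qed simp
      finally show ?thesis .
    qed
  qed
qed

text \<open>
  In the expansion by the last factor only the term that removes the first letter contributes, with
  sign \<open>(-1)\<^sup>m\<close> for \<open>m\<close> remaining letters; these signs multiply up to the sign of the reversal.
\<close>

lemma lookup_alt_rev:
  "distinct xs \<Longrightarrow>
    Poly_Mapping.lookup (alt (map fa_var xs)) (rev xs) = ((-1) ^ (length xs div 2) :: 'f::field)"
proof (induction xs)
  case Nil
  then show ?case by (simp add: alt_def lookup_one zero_list_def)
next
  case (Cons x xs)
  let ?m = "length xs"
  have "Poly_Mapping.lookup (alt (map fa_var (x # xs))) (rev (x # xs)) = (\<Sum>q<Suc ?m.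
      if q = 0 then (-1) ^ ?m * Poly_Mapping.lookup (alt (map fa_var xs)) (rev xs) else 0 :: 'f)"
    unfolding alt_expand_last[of "x # xs", OF length_Cons] Poly_Mapping.lookup_sum lookup_sign_times
    by (rule sum.cong) (use Cons.prems in
      \<open>auto simp: lookup_times_letter delete_nth_def nth_Cons split: nat.splits\<close>)
  also have "\<dots> = (-1) ^ ?m * (-1) ^ (?m div 2)"
    using Cons by (simp add: sum.delta del: sum.lessThan_Suc)
  also have "\<dots> = (-1) ^ (length (x # xs) div 2)"
    by (cases "even ?m") (auto elim!: evenE oddE)
  finally show ?case .
qed

lemma descending_greatest:
  assumes "sorted_wrt (>) d" and "mset w = mset d" and "w \<noteq> d"
  shows "(w, d) \<in> deglex"
  using assms
proof (induction d arbitrary: w)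
  case (Cons x d)
  obtain y v where w: "w = y # v" using Cons.prems(2) by (cases w) auto
  have len: "length v = length d" using Cons.prems(2) w by (metis Suc_inject length_Cons mset_eq_length)
  have "y \<in> set (x # d)" using Cons.prems(2) w by (metis list.set_intros(1) mset_eq_setD)
  then consider "y < x" | "y = x" using Cons.prems(1) by auto
  then show ?case
  proof cases
    case 2
    then have "(v, d) \<in> deglex" using Cons w by auto
    then show ?thesis using 2 w by (simp add: deglex_def Cons_lenlex_iff)
  qed (use w len in \<open>simp add: deglex_def Cons_lenlex_iff\<close>)
qed simp

section \<open>The generators and their leading words\<close>

lemma indices_split: "i \<in> {1..n + 1} \<Longrightarrow> [1..<n + 2] = [1..<i] @ i # [Suc i..<n + 2]"
  using upt_add_eq_append[of 1 i "n + 2 - i"] upt_conv_Cons[of i "n + 2"] by (simp del: upt_Suc)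

lemma omit_eq: "i \<in> {1..n + 1} \<Longrightarrow> omit n i = [1..<i] @ [Suc i..<n + 2]"
  unfolding omit_def by (subst indices_split[of i n]) (simp_all add: filter_id_conv del: upt_Suc)

lemma omit_facts:
  "set (omit n i) = {1..n + 1} - {i}"
  "sorted_wrt (<) (omit n i)"
  "distinct (omit n i)"
  "i \<in> {1..n + 1} \<Longrightarrow> length (omit n i) = n"
  using omit_eq[of i n] by (auto simp: omit_def sorted_wrt_filter simp del: upt_Suc)

lemma omit_delete_nth: "q < Suc n \<Longrightarrow> omit n (Suc q) = delete_nth q [1..<n + 2]"
  by (subst omit_eq) (simp_all add: delete_nth_def del: upt_Suc)

text \<open>
  Both halves of the sum are the alternating sum over all \<open>n + 1\<close> letters: the term that removes the
  letter at position \<open>q\<close> has sign \<open>(-1)\<^sup>q\<close> in the expansion by the first factor and \<open>(-1)\<^sup>n\<^sup>+\<^sup>q\<close> in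
  the expansion by the last one, and \<open>n\<close> is even.
\<close>

lemma alternating_commutators_vanish:
  assumes "even n"
  shows "(\<Sum>q<Suc n. (-1) ^ q *
      (fa_var (Suc q) * alt (map fa_var (omit n (Suc q)))
        - alt (map fa_var (omit n (Suc q))) * fa_var (Suc q))) = (0 :: nat list \<Rightarrow>\<^sub>0 'f::field)"
proof -
  let ?xs = "[1..<n + 2]"
  have len: "length ?xs = Suc n" by simp
  have nth: "?xs ! q = Suc q" if "q < Suc n" for q using that by (simp add: nth_append del: upt_Suc)
  have "alt (map fa_var ?xs) = (\<Sum>q<Suc n.
      (-1) ^ q * (fa_var (Suc q) * alt (map fa_var (omit n (Suc q)))) :: nat list \<Rightarrow>\<^sub>0 'f)"
    by (subst alt_expand_first) (auto simp: nth omit_delete_nth simp del: upt_Suc sum.lessThan_Suc)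
  moreover have "alt (map fa_var ?xs) = (\<Sum>q<Suc n.
      (-1) ^ q * (alt (map fa_var (omit n (Suc q))) * fa_var (Suc q)) :: nat list \<Rightarrow>\<^sub>0 'f)"
    by (subst alt_expand_last[OF len])
      (use assms in \<open>auto simp: nth omit_delete_nth power_add simp del: upt_Suc sum.lessThan_Suc\<close>)
  ultimately show ?thesis
    by (simp add: right_diff_distrib sum_subtractf del: sum.lessThan_Suc)
qed

text \<open>
  The form that all \<open>G_gen n br e \<phi> i\<close> take once \<open>\<phi>\<close> sends each basis bracket to a multiple of
  the omitted letter.
\<close>

definition alt_generator :: "nat \<Rightarrow> (nat \<Rightarrow> 'f::field) \<Rightarrow> nat \<Rightarrow> (nat list \<Rightarrow>\<^sub>0 'f)" where
  "alt_generator n c i =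
    (-1) ^ (n div 2) * (alt (map fa_var (omit n i)) - Poly_Mapping.single [i] (c i))"

lemma alt_generator_keys:
  assumes "k \<in> Poly_Mapping.keys (alt_generator n c i)"
  shows "k = [i] \<or> mset k = mset (omit n i)"
  using assms keys_alt_letters[of k "omit n i", where 'f = 'a]
  by (auto simp: alt_generator_def in_keys_iff lookup_sign_times Poly_Mapping.lookup_minus
      Poly_Mapping.lookup_single when_def split: if_splits)

lemma alt_generator_commutators:
  assumes "even n"
  shows "(\<Sum>q<Suc n. (-1) ^ q *
    (fa_var (Suc q) * alt_generator n c (Suc q) - alt_generator n c (Suc q) * fa_var (Suc q))) = 0"
proof -
  have comm: "fa_var (Suc q) * alt_generator n c (Suc q) - alt_generator n c (Suc q) * fa_var (Suc q)
      = (-1) ^ (n div 2) * (fa_var (Suc q) * alt (map fa_var (omit n (Suc q)))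
        - alt (map fa_var (omit n (Suc q))) * fa_var (Suc q))" for q
    by (cases "even (n div 2)") (simp_all add: alt_generator_def algebra_simps fa_var_def
        Poly_Mapping.mult_single plus_list_def)
  have swap: "(-1) ^ q * ((-1) ^ (n div 2) * f) = (-1) ^ (n div 2) * ((-1) ^ q * f)"
    for q and f :: "nat list \<Rightarrow>\<^sub>0 'a"
    by (cases "even (n div 2)") simp_all
  show ?thesis
    unfolding comm swap sum_distrib_left[symmetric] alternating_commutators_vanish[OF assms] by simp
qed

lemma monic_family_alt_generator:
  assumes "n \<ge> 2"
  shows "monic_family {1..n + 1} (alt_generator n c) (\<lambda>i. rev (omit n i))"
proof
  fix i assume i: "i \<in> {1..n + 1}"
  have len: "length (omit n i) = n" using omit_facts(4)[OF i] .
  have "[i] \<noteq> rev (omit n i)" using len assms by (metis length_rev length_Cons list.size(3)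
        One_nat_def not_less_eq_eq numeral_2_eq_2 order_refl)
  then show "Poly_Mapping.lookup (alt_generator n c i) (rev (omit n i)) = 1"
    using lookup_alt_rev[OF omit_facts(3)[of n i], where 'f = 'a] len
    by (simp add: alt_generator_def lookup_sign_times Poly_Mapping.lookup_minus
        Poly_Mapping.lookup_single power_add[symmetric] mult_2[symmetric])
  fix k assume k: "k \<in> Poly_Mapping.keys (alt_generator n c i)" "k \<noteq> rev (omit n i)"
  from alt_generator_keys[OF k(1)] show "(k, rev (omit n i)) \<in> deglex"
  proof
    assume "k = [i]"
    then show ?thesis using len assms by (simp add: deglex_def lenlex_conv)
  next
    assume "mset k = mset (omit n i)"
    then show ?thesis using k(2) omit_facts(2)
      by (intro descending_greatest) (simp_all add: sorted_wrt_rev)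
  qed
qed

section \<open>The single overlap and its resolution\<close>

text \<open>
  The letters of \<open>a\<close> exceed those of \<open>b\<close>, and these exceed those of \<open>c\<close>. A letter of \<open>a\<close> therefore
  does not occur in \<open>b @ c\<close>, so it is the one letter \<open>j\<close> that is missing there, and being larger than
  all others it is \<open>n + 1\<close>. Symmetrically, \<open>c\<close> consists of the missing letter \<open>i\<close>, which is the smallest.
\<close>

lemma unique_overlap:
  assumes i: "i \<in> {1..n + 1}" and j: "j \<in> {1..n + 1}"
    and ab: "rev (omit n i) = a @ b" and bc: "rev (omit n j) = b @ c"
    and ne: "a \<noteq> []" "b \<noteq> []" "c \<noteq> []"
  shows "i = 1 \<and> j = n + 1 \<and> a = [n + 1] \<and> c = [1]"
proof -
  have "sorted_wrt (>) (a @ b)" "sorted_wrt (>) (b @ c)"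
    unfolding ab[symmetric] bc[symmetric] using omit_facts(2) by (simp_all add: sorted_wrt_rev)
  then have gt: "\<And>x y. x \<in> set a \<Longrightarrow> y \<in> set b \<Longrightarrow> y < x" "\<And>x y. x \<in> set b \<Longrightarrow> y \<in> set c \<Longrightarrow> y < x"
    by (auto simp: sorted_wrt_append)
  have dist: "distinct a" "distinct c"
    using omit_facts(3) by (metis ab distinct_append distinct_rev, metis bc distinct_append distinct_rev)
  have sets: "set a \<union> set b = {1..n + 1} - {i}" "set b \<union> set c = {1..n + 1} - {j}"
    using arg_cong[OF ab, of set] arg_cong[OF bc, of set] by (simp_all add: omit_facts(1))
  obtain m where m: "m \<in> set b" using ne by (cases b) auto
  have "set a \<subseteq> {j}"
  proof
    fix x assume x: "x \<in> set a"
    have "x \<notin> set b \<union> set c" using gt(1)[OF x] gt(1)[OF x m] gt(2)[OF m] by fastforce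
    then show "x \<in> {j}" using x sets by blast
  qed
  then have aj: "set a = {j}" using ne by (cases a) auto
  have "set c \<subseteq> {i}"
  proof
    fix x assume x: "x \<in> set c"
    have "x \<notin> set a \<union> set b" using gt(2)[OF _ x] gt(2)[OF m x] gt(1)[OF _ m] by fastforce
    then show "x \<in> {i}" using x sets by blast
  qed
  then have ci: "set c = {i}" using ne by (cases c) auto
  have "j = n + 1"
  proof (rule ccontr)
    assume "j \<noteq> n + 1"
    then have "n + 1 \<in> set b \<union> set c" using sets(2) by simp
    moreover have "j \<in> set a" using aj by simp
    ultimately have "n + 1 < j"
      using gt(1)[of j "n + 1"] gt(1)[OF _ m, of j] gt(2)[OF m, of "n + 1"] by auto
    then show False using j by simp
  qed
  moreover have "i = 1"
  proof (rule ccontr)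
    assume "i \<noteq> 1"
    then have "1 \<in> set a \<union> set b" using sets(1) by simp
    moreover have "i \<in> set c" using ci by simp
    ultimately have "i < 1" using gt(2)[of 1 i] gt(2)[OF m, of i] gt(1)[OF _ m, of 1] by auto
    then show False using i by simp
  qed
  moreover have "length a = Suc 0" "length c = Suc 0"
    using distinct_card[OF dist(1)] distinct_card[OF dist(2)] aj ci by simp_all
  then have "a = [j]" "c = [i]" using aj ci by (auto simp: length_Suc_conv)
  ultimately show ?thesis by simp
qed

lemma resolvable_family_alt_generator:
  fixes c :: "nat \<Rightarrow> 'f::field"
  assumes n: "n \<ge> 2" "even n"
  shows "resolvable_family {1..n + 1} (alt_generator n c) (\<lambda>i. rev (omit n i))"
proof -
  interpret monic_family "{1..n + 1}" "alt_generator n c" "\<lambda>i. rev (omit n i)"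
    by (rule monic_family_alt_generator[OF n(1)])
  show ?thesis
  proof
    fix i j assume i: "i \<in> {1..n + 1}" and j: "j \<in> {1..n + 1}"
    assume "sublist (rev (omit n i)) (rev (omit n j))"
    then obtain p s where ps: "rev (omit n j) = p @ rev (omit n i) @ s" by (auto simp: sublist_def)
    have "p = []" "s = []"
      using arg_cong[OF ps, of length] omit_facts(4)[OF i] omit_facts(4)[OF j] by simp_all
    then have "{1..n + 1} - {i} = {1..n + 1} - {j}"
      using arg_cong[OF ps, of set] by (simp add: omit_facts(1))
    then show "i = j" using i j by blast
  next
    fix i j a b d
    assume i: "i \<in> {1..n + 1}" and j: "j \<in> {1..n + 1}"
      and ab: "rev (omit n i) = a @ b" and bd: "rev (omit n j) = b @ d"
      and ne: "a \<noteq> []" "b \<noteq> []" "d \<noteq> []"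
    let ?W = "rev [1..<n + 2]" and ?g = "alt_generator n c"
    have eqs: "i = 1" "j = n + 1" "a = [n + 1]" "d = [1]"
      using unique_overlap[OF i j ab bd ne] by simp_all
    have "[1..<n + 2] = 1 # omit n 1"
      using upt_conv_Cons[of 1 "n + 2"] omit_eq[of 1 n] by simp
    then have W: "a @ b @ d = ?W"
      using ab eqs by (simp del: upt_Suc)
    have sorted: "sorted_wrt (>) ?W" by (simp add: sorted_wrt_rev del: upt_Suc)
    have mset: "mset (omit n k) + {#k#} = mset ?W" if "k \<in> {1..n + 1}" for k
      using omit_eq[OF that] by (subst indices_split[OF that]) (simp del: upt_Suc)
    have left: "fa_var k * ?g k \<in> below ?W" if k: "k \<in> {1..n}" for k
    proof -
      have "hd ?W = n + 1" by (simp add: hd_rev)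
      then have "hd ([k] @ rev (omit n k) @ []) \<noteq> hd ?W" using k by simp
      then have "[k] @ rev (omit n k) @ [] \<noteq> ?W" by (rule contrapos_nn) (rule arg_cong)
      then have "([k] @ rev (omit n k) @ [], ?W) \<in> deglex"
        using k mset[of k] by (intro descending_greatest[OF sorted]) (auto simp del: upt_Suc)
      then show ?thesis using multiple_in[of k _ "[k]" "[]"] k by (simp add: word_Nil fa_var_def)
    qed
    have right: "?g k * fa_var k \<in> below ?W" if k: "k \<in> {2..n + 1}" for k
    proof -
      have "last ?W = 1" by (simp add: last_rev hd_append del: upt_Suc)
      then have "last ([] @ rev (omit n k) @ [k]) \<noteq> last ?W" using k by simp
      then have "[] @ rev (omit n k) @ [k] \<noteq> ?W" by (rule contrapos_nn) (rule arg_cong)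
      then have "([] @ rev (omit n k) @ [k], ?W) \<in> deglex"
        using k mset[of k] by (intro descending_greatest[OF sorted]) (auto simp del: upt_Suc)
      then show ?thesis using multiple_in[of k _ "[]" "[k]"] k by (simp add: word_Nil fa_var_def)
    qed
    let ?C = "\<lambda>q. (-1) ^ q * (fa_var (Suc q) * ?g (Suc q) - ?g (Suc q) * fa_var (Suc q))"
    \<comment> \<open>The summands for \<open>q = 0\<close> and \<open>q = n\<close> contain the two products \<open>G\<^sub>1 x\<^sub>1\<close> and \<open>x\<^sub>n\<^sub>+\<^sub>1 G\<^sub>n\<^sub>+\<^sub>1\<close>
      that form the overlap; all other products have smaller leading words.\<close>
    have "(\<Sum>q<Suc n. ?C q) = ?C 0 + (\<Sum>q = 1..<n. ?C q) + ?C n"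
      using n(1) by (simp add: lessThan_atLeast0 sum.atLeast_Suc_lessThan)
    then have "?C 0 + (\<Sum>q = 1..<n. ?C q) + ?C n = 0"
      using alt_generator_commutators[OF n(2), of c] by simp
    then have "?g i * word d - word a * ?g j
        = fa_var 1 * ?g 1 + (\<Sum>q = 1..<n. ?C q) - ?g (n + 1) * fa_var (n + 1)"
      using n(2) by (simp add: eqs fa_var_def algebra_simps)
    also have "\<dots> \<in> below ?W"
    proof (intro multiples_diff multiples_add multiples_sum)
      fix q assume q: "q \<in> {1..<n}"
      then show "?C q \<in> below ?W" by (intro multiples_sign multiples_diff left right) auto
    qed (use left[of 1] right[of "n + 1"] n(1) in auto)
    finally show "?g i * word d - word a * ?g j \<in> below (a @ b @ d)" unfolding W .
  qed
qed

section \<open>The four families of algebras\<close>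

context n_Lie_algebra
begin

text \<open>
  This is how the classification enters the proof: the image of each of these brackets under \<open>\<phi>\<close> is a
  multiple of \<open>x\<^sub>i\<close> and so commutes with \<open>x\<^sub>i\<close>.
\<close>

lemma basis_brackets:
  assumes n: "n \<ge> 1"
    and cases: "case_0 \<or> case_1a e \<or> case_2a e \<or> (\<exists>r\<in>{3..n}. case_r e r)"
    and i: "i \<in> {1..n + 1}"
  shows "br (map e (omit n i)) \<in> {0, e i}"
proof -
  have unlisted: "br (map e (omit n i)) = 0"
    if "unlisted_brackets_zero e S" "i \<notin> S" "S \<subseteq> {1..n + 1}" for S
  proof -
    have "mset (omit n i) \<noteq> mset (omit n k)" if "k \<in> S" for k
    proof
      assume "mset (omit n i) = mset (omit n k)"
      then have "{1..n + 1} - {i} = {1..n + 1} - {k}" by (metis mset_eq_setD omit_facts(1))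
      then show False using that \<open>i \<notin> S\<close> \<open>S \<subseteq> {1..n + 1}\<close> i by blast
    qed
    then show ?thesis
      using that(1) omit_facts(1)[of n i] omit_facts(4)[OF i]
      unfolding unlisted_brackets_zero_def by auto
  qed
  have omit1: "omit n 1 = [2..<n + 2]" using omit_eq[of 1 n] by (simp add: numeral_2_eq_2)
  from cases show ?thesis
  proof (elim disjE bexE)
    assume case_0
    moreover have "br (map e (omit n i)) \<in> derived_algebra"
      unfolding derived_algebra_def by (rule span_base) (use omit_facts(4)[OF i] in auto)
    ultimately show ?thesis by (simp add: case_0_def)
  next
    assume "case_1a e"
    then show ?thesis using unlisted[of "{1}"] omit1 by (cases "i = 1") (auto simp: case_1a_def)
  next
    assume c: "case_2a e"
    show ?thesis
    proof (cases "i = 2")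
      case True
      then have "omit n 2 = 1 # [3..<n + 2]" using omit_eq[of 2 n] i by (simp add: numeral_eq_Suc)
      then show ?thesis using c True by (simp add: case_2a_def)
    next
      case False
      then show ?thesis using c unlisted[of "{1, 2}"] omit1 n
        by (cases "i = 1") (auto simp: case_2a_def)
    qed
  next
    fix r assume "r \<in> {3..n}" "case_r e r"
    then show ?thesis using unlisted[of "{1..r}"] i by (cases "i \<le> r") (auto simp: case_r_def)
  qed
qed

end

theorem theorem5p1:
  fixes scale :: "'f::{alg_closed_field, field_char_0} \<Rightarrow> 'l::ab_group_add \<Rightarrow> 'l"
    and n :: nat
    and br :: "'l list \<Rightarrow> 'l"
    and e :: "nat \<Rightarrow> 'l"
    and \<phi> :: "'l \<Rightarrow> (nat list \<Rightarrow>\<^sub>0 'f)"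
  assumes n: "n \<ge> 4" "even n"
    and L: "n_Lie_algebra scale n br"
    and basis: "n_Lie_algebra.is_basis scale n e"
    and cases: "n_Lie_algebra.case_0 scale n br
      \<or> n_Lie_algebra.case_1a scale n br e
      \<or> n_Lie_algebra.case_2a scale n br e
      \<or> (\<exists>r\<in>{3..n}. n_Lie_algebra.case_r scale n br e r)"
    and phi_linear: "Vector_Spaces.linear scale fa_scale \<phi>"
    and phi_basis: "\<And>i. i \<in> {1..n + 1} \<Longrightarrow> \<phi> (e i) = fa_var i"
  shows "Groebner_basis {1..n + 1}
    (Idl\<^bsub>free_algebra {1..n + 1}\<^esub> (G_gen n br e \<phi> ` {1..n + 1}))
    (G_gen n br e \<phi> ` {1..n + 1})"
proof -
  define c :: "nat \<Rightarrow> 'f" where "c i = (if br (map e (omit n i)) = 0 then 0 else 1)" for i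
  interpret phi: Vector_Spaces.linear scale fa_scale \<phi> by (rule phi_linear)
  have "\<phi> (br (map e (omit n i))) = Poly_Mapping.single [i] (c i)" if "i \<in> {1..n + 1}" for i
    using n_Lie_algebra.basis_brackets[OF L _ cases that] phi_basis[OF that] phi.zero n(1)
    by (auto simp: c_def fa_var_def)
  then have gen: "G_gen n br e \<phi> i = alt_generator n c i" if "i \<in> {1..n + 1}" for i
    using that by (simp add: G_gen_def alt_generator_def)
  interpret resolvable_family "{1..n + 1}" "alt_generator n c" "\<lambda>i. rev (omit n i)"
    by (rule resolvable_family_alt_generator) (use n in auto)
  have "set k \<subseteq> {1..n + 1}" if "i \<in> {1..n + 1}" "k \<in> Poly_Mapping.keys (alt_generator n c i)" for i k
    using alt_generator_keys[OF that(2)]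
  proof
    assume "mset k = mset (omit n i)"
    then have "set k = {1..n + 1} - {i}" by (metis mset_eq_setD omit_facts(1))
    then show ?thesis by blast
  qed (use that in simp)
  then have "alt_generator n c ` {1..n + 1} \<subseteq> carrier (free_algebra {1..n + 1})"
    by (intro image_subsetI) (simp only: free_algebra_def partial_object.simps mem_Collect_eq, blast)
  moreover have "G_gen n br e \<phi> ` {1..n + 1} = alt_generator n c ` {1..n + 1}"
    using gen by (rule image_cong[OF refl])
  ultimately show ?thesis using Groebner_basis_of_family[of "{1..n + 1}"] by simp
qed

end
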